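(* The dual cone of $D_4$-invariant sum of squares quaternary quartics is a simplicial cone with the following description: $$\left(\Sigma_{4,4}^{D_4}\right)^\ast=\operatorname{cone}\left\{\operatorname{ev}_{(1,0,0,0)},\operatorname{ev}_{(1,1,1,-1)},\operatorname{ev}_{(1,1,1,1)}\right\}.$$
   Context: $D_4$ is the group acting on $\mathbb{R}^4$ by coordinate permutations combined with an even number of sign changes. $H_{4,4}^{D_4}$ is the space of $D_4$-invariant real forms of degree 4 in four variables, and $\Sigma_{4,4}^{D_4}$ the cone of those that are sums of squares of real forms. For a cone $K\subset V$, $K^\ast=\{\ell\in\operatorname{Hom}(V,\mathbb{R}):\ell(K)\subseteq\mathbb{R}_{\geq0}\}$; here $V=H_{4,4}^{D_4}$. $\operatorname{ev}_z$ is the functional $f\mapsto f(z)$ on $H_{4,4}^{D_4}$, and $\operatorname{cone}$ denotes the generated convex cone. A simplicial cone is a convex cone generated by linearly independent vectors. *)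

theory Defs
  imports "HOL-Analysis.Analysis" "HOL-Library.Function_Algebras" "HOL-Library.Poly_Mapping"
    "HOL-Analysis.Finite_Function_Topology"
begin

section \<open>Functions into a vector space as a vector space\<close>

instantiation "fun" :: (type, real_vector) real_vector
begin

definition scaleR_fun_def: "c *\<^sub>R f = (\<lambda>x. c *\<^sub>R f x)"

instance
  by standard (simp_all add: scaleR_fun_def fun_eq_iff scaleR_add_left scaleR_add_right)

end

section \<open>Cones and dual cones\<close>

definition dual_cone :: "'a::real_vector set \<Rightarrow> ('a \<Rightarrow> real) set"
  where "dual_cone K = {l. linear l \<and> (\<forall>f\<in>K. 0 \<le> l f)}"

definition simplicial_cone :: "'a::real_vector set \<Rightarrow> bool"
  where "simplicial_cone K \<longleftrightarrow> (\<exists>B. finite B \<and> independent B \<and> K = convex_cone hull B)"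

section \<open>Real polynomials in finitely many variables\<close>

text \<open>A polynomial is the finitely supported map from exponent vectors to coefficients, so that
  addition, scaling and multiplication are the library operations on \<^type>\<open>poly_mapping\<close>.\<close>

type_synonym 'n rpoly = "('n \<Rightarrow>\<^sub>0 nat) \<Rightarrow>\<^sub>0 real"

definition homogeneous :: "nat \<Rightarrow> 'n::finite rpoly \<Rightarrow> bool"
  where "homogeneous d p \<longleftrightarrow>
    (\<forall>m\<in>Poly_Mapping.keys p. (\<Sum>i\<in>UNIV. Poly_Mapping.lookup m i) = d)"

definition real_form :: "'n::finite rpoly \<Rightarrow> bool"
  where "real_form p \<longleftrightarrow> (\<exists>d. homogeneous d p)"

definition poly_eval :: "'n::finite rpoly \<Rightarrow> real ^ 'n \<Rightarrow> real"
  where "poly_eval p x =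
    (\<Sum>m\<in>Poly_Mapping.keys p. Poly_Mapping.lookup p m * (\<Prod>i\<in>UNIV. (x $ i) ^ Poly_Mapping.lookup m i))"

definition sum_of_squares :: "'n::finite rpoly \<Rightarrow> bool"
  where "sum_of_squares p \<longleftrightarrow> (\<exists>qs. (\<forall>q\<in>set qs. real_form q) \<and> p = (\<Sum>q\<leftarrow>qs. q ^ 2))"

section \<open>The group and its invariant quartics\<close>

definition D4 :: "(real ^ 4 \<Rightarrow> real ^ 4) set"
  where "D4 = {(\<lambda>x. \<chi> i. s i * x $ \<pi> i) | \<pi> s.
    \<pi> permutes UNIV \<and> (\<forall>i. s i = 1 \<or> s i = -1) \<and> even (card {i. s i = -1})}"

text \<open>Invariance of a polynomial under the induced action is expressed through its values, which
  determine a real polynomial.\<close>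

definition D4_invariant :: "4 rpoly \<Rightarrow> bool"
  where "D4_invariant p \<longleftrightarrow> (\<forall>g\<in>D4. \<forall>x. poly_eval p (g x) = poly_eval p x)"

lemma poly_eval_zero: "poly_eval 0 x = 0"
  by (simp add: poly_eval_def)

lemma poly_eval_add: "poly_eval (p + q) x = poly_eval p x + poly_eval q x"
  unfolding poly_eval_def
  by (rule setsum_keys_plus_distrib) (simp_all add: distrib_right)

lemma lookup_scaleR:
  fixes p :: "'a \<Rightarrow>\<^sub>0 'b::real_vector"
  shows "Poly_Mapping.lookup (c *\<^sub>R p) m = c *\<^sub>R Poly_Mapping.lookup p m"
proof -
  have "finite {i. c *\<^sub>R Poly_Mapping.lookup p i \<noteq> 0}"
    by (rule finite_subset[OF _ finite_keys[of p]]) (auto simp: in_keys_iff)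
  then show ?thesis
    by (simp add: scaleR_poly_mapping_def lookup_Abs_poly_mapping)
qed

lemma keys_scaleR_subset:
  fixes p :: "'a \<Rightarrow>\<^sub>0 'b::real_vector"
  shows "Poly_Mapping.keys (c *\<^sub>R p) \<subseteq> Poly_Mapping.keys p"
  by (auto simp: in_keys_iff lookup_scaleR)

lemma poly_eval_scaleR: "poly_eval (c *\<^sub>R p) x = c * poly_eval p x"
proof -
  have "poly_eval (c *\<^sub>R p) x = (\<Sum>m\<in>Poly_Mapping.keys p.
      Poly_Mapping.lookup (c *\<^sub>R p) m * (\<Prod>i\<in>UNIV. (x $ i) ^ Poly_Mapping.lookup m i))"
    unfolding poly_eval_def
    by (rule sum.mono_neutral_left) (auto simp: in_keys_iff lookup_scaleR)
  then show ?thesis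
    by (simp add: poly_eval_def lookup_scaleR sum_distrib_left mult.assoc)
qed

lemma homogeneous_zero: "homogeneous d 0"
  by (simp add: homogeneous_def)

lemma homogeneous_add: "homogeneous d p \<Longrightarrow> homogeneous d q \<Longrightarrow> homogeneous d (p + q)"
  using Poly_Mapping.keys_add[of p q] by (auto simp: homogeneous_def)

lemma homogeneous_scaleR: "homogeneous d p \<Longrightarrow> homogeneous d (c *\<^sub>R p)"
  using keys_scaleR_subset[of c p] by (auto simp: homogeneous_def)

lemma D4_invariant_zero: "D4_invariant 0"
  by (simp add: D4_invariant_def poly_eval_zero)

lemma D4_invariant_add: "D4_invariant p \<Longrightarrow> D4_invariant q \<Longrightarrow> D4_invariant (p + q)"
  by (simp add: D4_invariant_def poly_eval_add)

lemma D4_invariant_scaleR: "D4_invariant p \<Longrightarrow> D4_invariant (c *\<^sub>R p)"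
  by (simp add: D4_invariant_def poly_eval_scaleR)

text \<open>The space of invariant quartic forms is made a type of its own, so that the functionals in
  its dual space are exactly the linear functions on this type.\<close>

typedef D4_quartic = "{p :: 4 rpoly. homogeneous 4 p \<and> D4_invariant p}"
  morphisms poly_of D4_quartic_of
  using homogeneous_zero D4_invariant_zero by blast

setup_lifting type_definition_D4_quartic

instantiation D4_quartic :: real_vector
begin

lift_definition zero_D4_quartic :: D4_quartic is 0
  by (simp add: homogeneous_zero D4_invariant_zero)

lift_definition plus_D4_quartic :: "D4_quartic \<Rightarrow> D4_quartic \<Rightarrow> D4_quartic" is "(+)"
  by (simp add: homogeneous_add D4_invariant_add)

lift_definition scaleR_D4_quartic :: "real \<Rightarrow> D4_quartic \<Rightarrow> D4_quartic" is "(*\<^sub>R)"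
  by (simp add: homogeneous_scaleR D4_invariant_scaleR)

lift_definition uminus_D4_quartic :: "D4_quartic \<Rightarrow> D4_quartic" is uminus
  by (metis homogeneous_scaleR D4_invariant_scaleR scaleR_minus1_left)

lift_definition minus_D4_quartic :: "D4_quartic \<Rightarrow> D4_quartic \<Rightarrow> D4_quartic" is "(-)"
  by (metis homogeneous_scaleR D4_invariant_scaleR scaleR_minus1_left
      homogeneous_add D4_invariant_add diff_conv_add_uminus)

instance
  by standard (transfer; simp add: algebra_simps)+

end

definition Sigma_D4 :: "D4_quartic set"
  where "Sigma_D4 = {f. sum_of_squares (poly_of f)}"

definition ev :: "real ^ 4 \<Rightarrow> D4_quartic \<Rightarrow> real"
  where "ev z f = poly_eval (poly_of f) z"

end

theory Submission
  imports Defs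
begin

text \<open>The invariant quartics are spanned by \<open>p = \<Sum> x\<^sub>i\<^sup>4\<close>, \<open>q = \<Sum>\<^sub>i\<^sub><\<^sub>j x\<^sub>i\<^sup>2x\<^sub>j\<^sup>2\<close> and
  \<open>e = x\<^sub>1x\<^sub>2x\<^sub>3x\<^sub>4\<close>.  The forms \<open>3p - 2q = \<Sum>\<^sub>i\<^sub><\<^sub>j (x\<^sub>i\<^sup>2 - x\<^sub>j\<^sup>2)\<^sup>2\<close> and
  \<open>q \<plusminus> 6e = (x\<^sub>1x\<^sub>2 \<plusminus> x\<^sub>3x\<^sub>4)\<^sup>2 + (x\<^sub>1x\<^sub>3 \<plusminus> x\<^sub>2x\<^sub>4)\<^sup>2 + (x\<^sub>1x\<^sub>4 \<plusminus> x\<^sub>2x\<^sub>3)\<^sup>2\<close> are sums of squares, and up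
  to positive factors they are the basis dual to the three point evaluations.  So a functional is
  the combination of the evaluations whose coefficients are positive multiples of its values on
  three sums of squares.\<close>

section \<open>Polynomials as functions\<close>

definition monomial_eval :: "('n::finite \<Rightarrow>\<^sub>0 nat) \<Rightarrow> real ^ 'n \<Rightarrow> real"
  where "monomial_eval m x = (\<Prod>i\<in>UNIV. (x $ i) ^ Poly_Mapping.lookup m i)"

lemma monomial_eval_add: "monomial_eval (m + n) x = monomial_eval m x * monomial_eval n x"
  by (simp add: monomial_eval_def lookup_add power_add prod.distrib)

text \<open>Monomials are characters of the monoid of vectors under the componentwise product, whose
  unit is the all-ones vector. This feeds the independence argument, and it also handles sign
  changes, which act by such a product.\<close>

lemma monomial_eval_mult: "monomial_eval m (\<chi> i. x $ i * y $ i) = monomial_eval m x * monomial_eval m y"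
  by (simp add: monomial_eval_def power_mult_distrib prod.distrib)

lemma monomial_eval_one: "monomial_eval m (\<chi> i. 1) = 1"
  by (simp add: monomial_eval_def)

lemma poly_eval_superset:
  assumes "finite S" "Poly_Mapping.keys p \<subseteq> S"
  shows "poly_eval p x = (\<Sum>m\<in>S. Poly_Mapping.lookup p m * monomial_eval m x)"
  unfolding poly_eval_def monomial_eval_def
  by (rule sum.mono_neutral_left) (use assms in \<open>auto simp: in_keys_iff\<close>)

lemma poly_eval_keys:
  "poly_eval p x = (\<Sum>m\<in>Poly_Mapping.keys p. Poly_Mapping.lookup p m * monomial_eval m x)"
  by (simp add: poly_eval_superset)

lemma poly_eval_single: "poly_eval (Poly_Mapping.single m c) x = c * monomial_eval m x"
  by (subst poly_eval_superset[of "{m}"]) auto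

lemma poly_eval_diff: "poly_eval (p - q) x = poly_eval p x - poly_eval q x"
  using poly_eval_add[of "p - q" q x] by simp

lemma poly_eval_sum: "poly_eval (\<Sum>a\<in>A. f a) x = (\<Sum>a\<in>A. poly_eval (f a) x)"
  by (induction A rule: infinite_finite_induct) (simp_all add: poly_eval_zero poly_eval_add)

lemma sum_single_lookup: "(\<Sum>m\<in>Poly_Mapping.keys p. Poly_Mapping.single m (Poly_Mapping.lookup p m)) = p"
  by (rule poly_mapping_eqI) (simp add: lookup_sum lookup_single when_def in_keys_iff)

text \<open>By distributivity it suffices to treat single terms, where it is
  \<open>monomial_eval_add\<close>.\<close>

lemma poly_eval_mult: "poly_eval (p * q) x = poly_eval p x * poly_eval q x"
proof -
  have "p * q = (\<Sum>m\<in>Poly_Mapping.keys p. Poly_Mapping.single m (Poly_Mapping.lookup p m)) *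
      (\<Sum>n\<in>Poly_Mapping.keys q. Poly_Mapping.single n (Poly_Mapping.lookup q n))"
    by (simp add: sum_single_lookup)
  also have "poly_eval \<dots> x = poly_eval p x * poly_eval q x"
    by (simp add: sum_product mult_single poly_eval_sum poly_eval_single poly_eval_keys[of p]
        poly_eval_keys[of q] monomial_eval_add mult_ac)
  finally show ?thesis .
qed

lemma poly_eval_one: "poly_eval 1 x = 1"
  using poly_eval_single[of 0 1 x] by (simp add: monomial_eval_def)

lemma poly_eval_power: "poly_eval (p ^ n) x = poly_eval p x ^ n"
  by (induction n) (simp_all add: poly_eval_one poly_eval_mult)

lemma poly_eval_prod: "poly_eval (\<Prod>a\<in>A. f a) x = (\<Prod>a\<in>A. poly_eval (f a) x)"
  by (induction A rule: infinite_finite_induct) (simp_all add: poly_eval_one poly_eval_mult)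

lemma poly_eval_sum_list: "poly_eval (\<Sum>a\<leftarrow>xs. f a) x = (\<Sum>a\<leftarrow>xs. poly_eval (f a) x)"
  by (induction xs) (simp_all add: poly_eval_zero poly_eval_add)

lemma sum_of_squares_nonneg: "sum_of_squares p \<Longrightarrow> 0 \<le> poly_eval p x"
  by (auto simp: sum_of_squares_def poly_eval_sum_list poly_eval_power intro!: sum_list_nonneg)

text \<open>Dedekind's argument for the independence of characters.\<close>

lemma monomial_eval_independent:
  fixes c :: "('n::finite \<Rightarrow>\<^sub>0 nat) \<Rightarrow> real"
  assumes "finite S" "\<And>x. (\<Sum>m\<in>S. c m * monomial_eval m x) = 0" "m \<in> S"
  shows "c m = 0"
  using assms
proof (induction S arbitrary: c m rule: finite_induct)
  case empty
  then show ?case by simp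
next
  case (insert k S)
  have S: "c n = 0" if "n \<in> S" for n
  proof -
    from that insert.hyps have "n \<noteq> k" by auto
    then obtain i where i: "Poly_Mapping.lookup n i \<noteq> Poly_Mapping.lookup k i"
      by (auto simp: poly_mapping_eq_iff fun_eq_iff)
    \<comment> \<open>With 2 at a coordinate where \<open>n\<close> and \<open>k\<close> differ and
      1 elsewhere, \<open>y\<close> separates their characters, since distinct powers of 2
      differ.\<close>
    define y :: "real ^ 'n" where "y = (\<chi> j. if j = i then 2 else 1)"
    have y: "monomial_eval m y = 2 ^ Poly_Mapping.lookup m i" for m
      by (simp add: monomial_eval_def y_def if_distrib[of "\<lambda>a. a ^ _"] cong: if_cong)
    \<comment> \<open>The relation at the product of \<open>x\<close> and \<open>y\<close>, minus
      \<open>monomial_eval k y\<close> times the relation at \<open>x\<close>: the term of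
      \<open>k\<close> cancels, leaving a relation over \<open>S\<close>.\<close>
    have "(\<Sum>m\<in>S. (c m * (monomial_eval m y - monomial_eval k y)) * monomial_eval m x) = 0" for x
    proof -
      have "(\<Sum>m\<in>S. (c m * (monomial_eval m y - monomial_eval k y)) * monomial_eval m x) =
          (\<Sum>m\<in>insert k S. c m * monomial_eval m (\<chi> i. x $ i * y $ i)) -
          monomial_eval k y * (\<Sum>m\<in>insert k S. c m * monomial_eval m x)"
        using insert.hyps
        by (simp add: monomial_eval_mult algebra_simps sum_subtractf sum_distrib_left)
      then show ?thesis by (simp only: insert.prems(1) mult_zero_right diff_self)
    qed
    from insert.IH[OF this that] have "c n * (monomial_eval n y - monomial_eval k y) = 0" .
    with i show ?thesis by (simp add: y)
  qed
  \<comment> \<open>Only the term of \<open>k\<close> is left; every monomial is 1 at the all-ones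
    vector.\<close>
  have "c k = 0"
    using insert.prems(1)[of "\<chi> i. 1"] insert.hyps by (simp add: S monomial_eval_one)
  with S insert.prems(2) show ?case by auto
qed

text \<open>The difference vanishes at every point, so its coefficients vanish by independence of
  the monomials. Polynomial identities below are thereby reduced to identities between
  values.\<close>

lemma poly_eval_inject:
  assumes "\<And>x. poly_eval p x = poly_eval q x"
  shows "p = q"
proof -
  have "(\<Sum>m\<in>Poly_Mapping.keys (p - q). Poly_Mapping.lookup (p - q) m * monomial_eval m x) = 0" for x
    using assms[of x] by (simp add: poly_eval_diff flip: poly_eval_keys)
  from monomial_eval_independent[OF _ this] have "Poly_Mapping.lookup (p - q) m = 0" for m
    by (cases "m \<in> Poly_Mapping.keys (p - q)") (auto simp: in_keys_iff)
  then show ?thesis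
    by (simp add: poly_mapping_eq_iff fun_eq_iff lookup_minus)
qed

section \<open>Homogeneity, and the variables as polynomials\<close>

lemma homogeneous_mult:
  assumes "homogeneous d p" "homogeneous e q"
  shows "homogeneous (d + e) (p * q)"
  using assms keys_mult[of p q]
  by (fastforce simp: homogeneous_def lookup_add sum.distrib)

lemma homogeneous_diff: "homogeneous d p \<Longrightarrow> homogeneous d q \<Longrightarrow> homogeneous d (p - q)"
  using homogeneous_add[of d p "(-1) *\<^sub>R q"] homogeneous_scaleR[of d q "-1"] by simp

lemma homogeneous_sum: "(\<And>a. a \<in> A \<Longrightarrow> homogeneous d (f a)) \<Longrightarrow> homogeneous d (\<Sum>a\<in>A. f a)"
  by (induction A rule: infinite_finite_induct) (simp_all add: homogeneous_zero homogeneous_add)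

definition var :: "'n::finite \<Rightarrow> 'n rpoly"
  where "var i = Poly_Mapping.single (Poly_Mapping.single i 1) 1"

lemma poly_eval_var: "poly_eval (var i) x = x $ i"
  by (simp add: var_def poly_eval_single monomial_eval_def lookup_single when_def
      if_distrib[of "\<lambda>n. _ ^ n"] cong: if_cong)

lemma homogeneous_var: "homogeneous 1 (var i)"
  by (simp add: homogeneous_def var_def lookup_single when_def)

lemma homogeneous_var_mult: "homogeneous 2 (var i * var j)"
  using homogeneous_mult[OF homogeneous_var homogeneous_var] by (simp add: numeral_2_eq_2)

lemmas poly_eval_simps = poly_eval_add poly_eval_diff poly_eval_scaleR poly_eval_sum
  poly_eval_mult poly_eval_power poly_eval_prod poly_eval_var poly_eval_zero

section \<open>Invariant quartics\<close>

lemma D4_invariant_permute: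
  assumes "D4_invariant f" "\<pi> permutes UNIV"
  shows "poly_eval f (\<chi> i. x $ \<pi> i) = poly_eval f x"
proof -
  have "(\<lambda>x. \<chi> i. (\<lambda>_. 1) i * x $ \<pi> i) \<in> D4"
    unfolding D4_def using assms(2) by (intro CollectI exI[of _ \<pi>] exI[of _ "\<lambda>_. 1"]) simp
  with assms(1) show ?thesis by (auto simp: D4_invariant_def)
qed

text \<open>The sign change is written as a componentwise product so that
  \<open>monomial_eval_mult\<close> applies to it.\<close>

lemma D4_invariant_flip:
  assumes "D4_invariant f" "j \<noteq> k"
  shows "poly_eval f (\<chi> i. (\<chi> i. if i = j \<or> i = k then -1 else 1) $ i * x $ i) = poly_eval f x"
proof -
  let ?s = "\<lambda>i. if i = j \<or> i = k then -1 else (1::real)"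
  have "{i. ?s i = -1} = {j, k}" by auto
  then have "(\<lambda>x. \<chi> i. ?s i * x $ id i) \<in> D4"
    unfolding D4_def using assms(2)
    by (intro CollectI exI[of _ id] exI[of _ ?s]) (simp add: permutes_id)
  with assms(1) show ?thesis by (auto simp: D4_invariant_def)
qed

text \<open>Flipping the signs of coordinates \<open>j\<close> and \<open>k\<close> multiplies the
  coefficient of \<open>m\<close> by -1 to the power \<open>m j + m k\<close>. Invariance and
  independence of the monomials force this sign to be 1 wherever the coefficient is nonzero.\<close>

lemma D4_invariant_parity:
  assumes f: "D4_invariant f" and m: "m \<in> Poly_Mapping.keys f" and jk: "j \<noteq> k"
  shows "even (Poly_Mapping.lookup m j + Poly_Mapping.lookup m k)"
proof -
  define s :: "real ^ 4" where "s = (\<chi> i. if i = j \<or> i = k then -1 else 1)"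
  have s: "monomial_eval n s = (-1) ^ (Poly_Mapping.lookup n j + Poly_Mapping.lookup n k)" for n
  proof -
    have "monomial_eval n s = (\<Prod>i\<in>{j,k}. (s $ i) ^ Poly_Mapping.lookup n i)"
      unfolding monomial_eval_def by (rule prod.mono_neutral_right) (auto simp: s_def)
    with jk show ?thesis by (simp add: s_def power_add)
  qed
  have "(\<Sum>n\<in>Poly_Mapping.keys f. (Poly_Mapping.lookup f n * (monomial_eval n s - 1)) *
      monomial_eval n x) = 0" for x
    using D4_invariant_flip[OF f jk, of x]
    by (simp add: poly_eval_keys monomial_eval_mult algebra_simps sum_subtractf flip: s_def)
  from monomial_eval_independent[OF _ this m]
  have "(-1::real) ^ (Poly_Mapping.lookup m j + Poly_Mapping.lookup m k) = 1"
    using m by (simp add: s in_keys_iff)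
  then show ?thesis by (metis neg_one_odd_power one_neq_neg_one)
qed

section \<open>Exponent vectors in four variables\<close>

definition exponent :: "nat \<Rightarrow> nat \<Rightarrow> nat \<Rightarrow> nat \<Rightarrow> (4 \<Rightarrow>\<^sub>0 nat)"
  where "exponent a b c d = Poly_Mapping.single 1 a + Poly_Mapping.single 2 b +
    Poly_Mapping.single 3 c + Poly_Mapping.single 4 d"

lemma lookup_exponent:
  "Poly_Mapping.lookup (exponent a b c d) 1 = a" "Poly_Mapping.lookup (exponent a b c d) 2 = b"
  "Poly_Mapping.lookup (exponent a b c d) 3 = c" "Poly_Mapping.lookup (exponent a b c d) 4 = d"
  by (simp_all add: exponent_def lookup_add lookup_single when_def)

lemma exponent_eq_iff:
  "exponent a b c d = exponent a' b' c' d' \<longleftrightarrow> a = a' \<and> b = b' \<and> c = c' \<and> d = d'"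
  by (metis lookup_exponent)

lemma exponent_lookup:
  "m = exponent (Poly_Mapping.lookup m 1) (Poly_Mapping.lookup m 2)
    (Poly_Mapping.lookup m 3) (Poly_Mapping.lookup m 4)"
  by (simp add: poly_mapping_eq_iff fun_eq_iff forall_4 lookup_exponent)

lemma prod_4: "prod f (UNIV::4 set) = f 1 * f 2 * f 3 * f 4"
  unfolding UNIV_4 by (simp add: mult_ac)

lemma vector_4:
  "(vector [a, b, c, d] :: real ^ 4) $ 1 = a" "(vector [a, b, c, d] :: real ^ 4) $ 2 = b"
  "(vector [a, b, c, d] :: real ^ 4) $ 3 = c" "(vector [a, b, c, d] :: real ^ 4) $ 4 = d"
  unfolding vector_def by simp_all

lemma monomial_eval_exponent:
  "monomial_eval (exponent a b c d) x = x $ 1 ^ a * x $ 2 ^ b * x $ 3 ^ c * x $ 4 ^ d"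
  by (simp add: monomial_eval_def prod_4 lookup_exponent)

text \<open>All four entries have the parity of \<open>a\<close>. If they are even, their halves sum
  to 2; if they are odd, each is at least 1, so each equals 1.\<close>

lemma same_parity_sum_4:
  fixes a b c d :: nat
  assumes "a + b + c + d = 4" "even (a + b)" "even (a + c)" "even (a + d)"
  shows "(a, b, c, d) \<in> {(4,0,0,0), (0,4,0,0), (0,0,4,0), (0,0,0,4), (2,2,0,0), (2,0,2,0),
    (2,0,0,2), (0,2,2,0), (0,2,0,2), (0,0,2,2), (1,1,1,1)}"
proof (cases "even a")
  case True
  with assms obtain a' b' c' d' where even: "a = 2 * a'" "b = 2 * b'" "c = 2 * c'" "d = 2 * d'"
    by (auto elim!: evenE)
  with assms have sum: "a' + b' + c' + d' = 2" by simp
  then have "a' = 0 \<or> a' = 1 \<or> a' = 2" "b' = 0 \<or> b' = 1 \<or> b' = 2" "c' = 0 \<or> c' = 1 \<or> c' = 2"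
    by linarith+
  with sum show ?thesis
    unfolding even by (elim disjE) simp_all
next
  case False
  with assms have "odd a" "odd b" "odd c" "odd d" by auto
  then have "1 \<le> a" "1 \<le> b" "1 \<le> c" "1 \<le> d" by (auto elim: oddE)
  with assms(1) have "a = 1" "b = 1" "c = 1" "d = 1" by linarith+
  then show ?thesis by simp
qed

text \<open>Even sign changes leave only the eleven exponents of \<open>same_parity_sum_4\<close>;
  transpositions then equate the coefficients of all fourth powers and those of all products of two
  squares.\<close>

lemma invariant_quartic_eval:
  assumes hom: "homogeneous 4 f" and inv: "D4_invariant f"
  obtains A B C where "\<And>x. poly_eval f x = A * (\<Sum>i\<in>UNIV. (x $ i) ^ 4) +
    B * ((\<Sum>i\<in>UNIV. (x $ i) ^ 2) ^ 2 - (\<Sum>i\<in>UNIV. (x $ i) ^ 4)) + C * (\<Prod>i\<in>UNIV. x $ i)"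
proof -
  let ?S = "{exponent 4 0 0 0, exponent 0 4 0 0, exponent 0 0 4 0, exponent 0 0 0 4,
    exponent 2 2 0 0, exponent 2 0 2 0, exponent 2 0 0 2, exponent 0 2 2 0, exponent 0 2 0 2,
    exponent 0 0 2 2, exponent 1 1 1 1}"
  let ?c = "\<lambda>a b c d. Poly_Mapping.lookup f (exponent a b c d)"
  have keys: "Poly_Mapping.keys f \<subseteq> ?S"
  proof
    fix m assume m: "m \<in> Poly_Mapping.keys f"
    let ?m = "Poly_Mapping.lookup m"
    have "?m 1 + ?m 2 + ?m 3 + ?m 4 = 4"
      using hom m by (simp add: homogeneous_def sum_4)
    from same_parity_sum_4[OF this] D4_invariant_parity[OF inv m]
    have "(?m 1, ?m 2, ?m 3, ?m 4) \<in> {(4,0,0,0), (0,4,0,0), (0,0,4,0), (0,0,0,4), (2,2,0,0),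
      (2,0,2,0), (2,0,0,2), (0,2,2,0), (0,2,0,2), (0,0,2,2), (1,1,1,1)}"
      by simp
    then show "m \<in> ?S"
      using exponent_lookup[of m] by auto
  qed
  have eval: "poly_eval f x = ?c 4 0 0 0 * x $ 1 ^ 4 + ?c 0 4 0 0 * x $ 2 ^ 4 +
      ?c 0 0 4 0 * x $ 3 ^ 4 + ?c 0 0 0 4 * x $ 4 ^ 4 +
      ?c 2 2 0 0 * (x $ 1 ^ 2 * x $ 2 ^ 2) + ?c 2 0 2 0 * (x $ 1 ^ 2 * x $ 3 ^ 2) +
      ?c 2 0 0 2 * (x $ 1 ^ 2 * x $ 4 ^ 2) + ?c 0 2 2 0 * (x $ 2 ^ 2 * x $ 3 ^ 2) +
      ?c 0 2 0 2 * (x $ 2 ^ 2 * x $ 4 ^ 2) + ?c 0 0 2 2 * (x $ 3 ^ 2 * x $ 4 ^ 2) +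
      ?c 1 1 1 1 * (x $ 1 * x $ 2 * x $ 3 * x $ 4)" for x
    by (subst poly_eval_superset[OF _ keys]) (simp_all add: exponent_eq_iff monomial_eval_exponent)
  have swap: "poly_eval f (\<chi> k. x $ Transposition.transpose i j k) = poly_eval f x" for i j x
    by (rule D4_invariant_permute[OF inv]) (simp add: permutes_swap_id)
  \<comment> \<open>At a unit vector only one fourth power survives.\<close>
  have fourth: "?c 0 4 0 0 = ?c 4 0 0 0" "?c 0 0 4 0 = ?c 4 0 0 0" "?c 0 0 0 4 = ?c 4 0 0 0"
    using swap[of "vector [1,0,0,0]" 1 2] swap[of "vector [1,0,0,0]" 1 3]
      swap[of "vector [1,0,0,0]" 1 4]
    by (simp_all add: eval vector_4 Transposition.transpose_def)
  \<comment> \<open>At a 0/1 vector with two ones the value is two fourth-power coefficients plus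
    one mixed coefficient. No transposition carries the support {1,2} to {3,4}, so the last equation
    passes through {1,4}.\<close>
  have mixed: "?c 2 0 2 0 = ?c 2 2 0 0" "?c 2 0 0 2 = ?c 2 2 0 0" "?c 0 2 2 0 = ?c 2 2 0 0"
      "?c 0 2 0 2 = ?c 2 2 0 0" "?c 0 0 2 2 = ?c 2 0 0 2"
    using swap[of "vector [1,1,0,0]" 2 3] swap[of "vector [1,1,0,0]" 2 4]
      swap[of "vector [1,1,0,0]" 1 3] swap[of "vector [1,1,0,0]" 1 4]
      swap[of "vector [1,0,0,1]" 1 3]
    by (simp_all add: eval fourth vector_4 Transposition.transpose_def)
  \<comment> \<open>The difference multiplied by \<open>B\<close> counts each product of two squares
    twice, hence the division by 2.\<close>
  show thesis
    by (rule that[of "?c 4 0 0 0" "?c 2 2 0 0 / 2" "?c 1 1 1 1"])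
      (simp add: eval fourth mixed sum_4 prod_4 power2_eq_square power4_eq_xxxx field_simps)
qed

section \<open>Invariant quartics with prescribed coefficients\<close>

text \<open>Permutations only reindex the sums and the product. Signs disappear in even powers, and
  in the product of the variables they contribute their own product, which is 1 because the number
  of minus signs is even.\<close>

lemma D4_invariant_span:
  "D4_invariant (a *\<^sub>R (\<Sum>i\<in>UNIV. var i ^ 4) + b *\<^sub>R (\<Sum>i\<in>UNIV. var i ^ 2) ^ 2 + c *\<^sub>R (\<Prod>i\<in>UNIV. var i))"
  unfolding D4_invariant_def
proof (intro ballI allI)
  fix g and x :: "real ^ 4"
  assume "g \<in> D4"
  then obtain \<pi> s where g: "g = (\<lambda>x. \<chi> i. s i * x $ \<pi> i)" and \<pi>: "\<pi> permutes UNIV"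
    and s: "\<And>i. s i = 1 \<or> s i = -1" and even: "even (card {i. s i = -1})"
    unfolding D4_def by blast
  have s_even: "s i ^ 2 = 1" "s i ^ 4 = 1" for i
    using s[of i] by auto
  have "(\<Prod>i\<in>UNIV. s i) = (\<Prod>i\<in>{i. s i = -1}. s i)"
    by (rule prod.mono_neutral_right) (use s in auto)
  also have "\<dots> = (\<Prod>i\<in>{i. s i = -1}. -1)"
    by (rule prod.cong) auto
  also have "\<dots> = 1"
    using even by simp
  finally have prod_s: "(\<Prod>i\<in>UNIV. s i) = 1" .
  have bij: "bij \<pi>"
    using \<pi> by (rule permutes_bij)
  note sum.reindex_bij_betw[OF bij, of "\<lambda>i. x $ i ^ 4"] sum.reindex_bij_betw[OF bij, of "\<lambda>i. x $ i ^ 2"]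
    prod.reindex_bij_betw[OF bij, of "\<lambda>i. x $ i"]
  then show "poly_eval (a *\<^sub>R (\<Sum>i\<in>UNIV. var i ^ 4) + b *\<^sub>R (\<Sum>i\<in>UNIV. var i ^ 2) ^ 2 +
      c *\<^sub>R (\<Prod>i\<in>UNIV. var i)) (g x) =
    poly_eval (a *\<^sub>R (\<Sum>i\<in>UNIV. var i ^ 4) + b *\<^sub>R (\<Sum>i\<in>UNIV. var i ^ 2) ^ 2 +
      c *\<^sub>R (\<Prod>i\<in>UNIV. var i)) x"
    by (simp add: poly_eval_simps g power_mult_distrib prod.distrib s_even prod_s)
qed

lemma homogeneous_span:
  "homogeneous 4 (a *\<^sub>R (\<Sum>i\<in>UNIV. var i ^ 4) + b *\<^sub>R (\<Sum>i\<in>UNIV. var i ^ 2) ^ 2 +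
    c *\<^sub>R (\<Prod>i\<in>UNIV. var (i::4)))"
proof -
  have quartic: "homogeneous 4 (p * q)" if "homogeneous 2 p" "homogeneous 2 q" for p q :: "4 rpoly"
    using homogeneous_mult[OF that] by simp
  have "homogeneous 4 (\<Sum>i\<in>UNIV. var (i::4) ^ 4)"
    using quartic[OF homogeneous_var_mult homogeneous_var_mult]
    by (intro homogeneous_sum) (simp add: power4_eq_xxxx mult.assoc)
  moreover have "homogeneous 4 ((\<Sum>i\<in>UNIV. var (i::4) ^ 2) ^ 2)"
    unfolding power2_eq_square by (intro quartic homogeneous_sum homogeneous_var_mult)
  moreover have "homogeneous 4 (\<Prod>i\<in>UNIV. var (i::4))"
    using quartic[OF homogeneous_var_mult homogeneous_var_mult] by (simp add: prod_4 mult.assoc)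
  ultimately show ?thesis
    by (intro homogeneous_add homogeneous_scaleR)
qed

lift_definition span_quartic :: "real \<Rightarrow> real \<Rightarrow> real \<Rightarrow> D4_quartic" is
  "\<lambda>a b c. a *\<^sub>R (\<Sum>i\<in>UNIV. var i ^ 4) + b *\<^sub>R (\<Sum>i\<in>UNIV. var i ^ 2) ^ 2 + c *\<^sub>R (\<Prod>i\<in>UNIV. var i)"
  by (simp add: homogeneous_span D4_invariant_span)

lemma ev_span_quartic:
  "ev x (span_quartic a b c) = a * (\<Sum>i\<in>UNIV. (x $ i) ^ 4) + b * (\<Sum>i\<in>UNIV. (x $ i) ^ 2) ^ 2 +
    c * (\<Prod>i\<in>UNIV. x $ i)"
  by (simp add: ev_def span_quartic.rep_eq poly_eval_simps)

lemma ev_add: "ev x (f + g) = ev x f + ev x g"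
  by (simp add: ev_def plus_D4_quartic.rep_eq poly_eval_add)

lemma ev_scaleR: "ev x (c *\<^sub>R f) = c * ev x f"
  by (simp add: ev_def scaleR_D4_quartic.rep_eq poly_eval_scaleR)

lemma D4_quartic_eqI: "(\<And>x. ev x f = ev x g) \<Longrightarrow> f = g"
  by (auto simp: ev_def poly_of_inject[symmetric] intro: poly_eval_inject)

lemma ev_mem_dual_cone: "ev x \<in> dual_cone Sigma_D4"
proof -
  have "linear (ev x)"
    by (rule linearI) (simp_all add: ev_add ev_scaleR)
  then show ?thesis
    by (simp add: dual_cone_def Sigma_D4_def ev_def sum_of_squares_nonneg)
qed

section \<open>The dual basis of sums of squares\<close>

text \<open>This is \<open>3p - 2q\<close>, since the square of the sum of the squared variables is
  \<open>p + 2q\<close>.\<close>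

definition square_diffs :: D4_quartic
  where "square_diffs = span_quartic 4 (-1) 0"

text \<open>This is \<open>q + 6te\<close>; the cases of interest are \<open>t = 1\<close> and
  \<open>t = -1\<close>.\<close>

definition pair_squares :: "real \<Rightarrow> D4_quartic"
  where "pair_squares t = span_quartic (-1/2) (1/2) (6 * t)"

lemma square_diffs_sos: "square_diffs \<in> Sigma_D4"
proof -
  let ?q = "\<lambda>i j. var i * var i - var j * var j :: 4 rpoly"
  let ?qs = "[?q 1 2, ?q 1 3, ?q 1 4, ?q 2 3, ?q 2 4, ?q 3 4]"
  have "poly_of square_diffs = (\<Sum>q\<leftarrow>?qs. q ^ 2)"
    by (rule poly_eval_inject, fold ev_def,
        simp only: list.map sum_list.Cons sum_list.Nil poly_eval_simps)
      (simp add: square_diffs_def ev_span_quartic sum_4 prod_4 algebra_simps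
        power2_eq_square power4_eq_xxxx)
  moreover have "real_form q" if "q \<in> set ?qs" for q
    using that
    by (auto simp: real_form_def intro!: exI[of _ 2] homogeneous_diff homogeneous_var_mult)
  ultimately show ?thesis
    unfolding Sigma_D4_def sum_of_squares_def by blast
qed

text \<open>There is one square for each splitting of the four indices into two pairs. The three
  cross terms \<open>2te\<close> add up to \<open>6te\<close>, and \<open>t ^ 2 = 1\<close> makes
  the remaining terms add up to \<open>q\<close>.\<close>

lemma pair_squares_sos:
  assumes "t = 1 \<or> t = -1"
  shows "pair_squares t \<in> Sigma_D4"
proof -
  let ?q = "\<lambda>i j k l. var i * var j + t *\<^sub>R (var k * var l) :: 4 rpoly"
  let ?qs = "[?q 1 2 3 4, ?q 1 3 2 4, ?q 1 4 2 3]"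
  have "poly_of (pair_squares t) = (\<Sum>q\<leftarrow>?qs. q ^ 2)"
    by (rule poly_eval_inject, fold ev_def,
        simp only: list.map sum_list.Cons sum_list.Nil poly_eval_simps)
      (use assms in \<open>elim disjE; simp add: pair_squares_def ev_span_quartic sum_4 prod_4
        algebra_simps power2_eq_square power4_eq_xxxx\<close>)
  moreover have "real_form q" if "q \<in> set ?qs" for q
    using that
    by (auto simp: real_form_def
        intro!: exI[of _ 2] homogeneous_add homogeneous_scaleR homogeneous_var_mult)
  ultimately show ?thesis
    unfolding Sigma_D4_def sum_of_squares_def by blast
qed

abbreviation (input) "e1 \<equiv> vector [1, 0, 0, 0] :: real ^ 4"
abbreviation (input) "eminus \<equiv> vector [1, 1, 1, -1] :: real ^ 4"
abbreviation (input) "eplus \<equiv> vector [1, 1, 1, 1] :: real ^ 4"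

lemma ev_dual_basis:
  "ev e1 square_diffs = 3" "ev eminus square_diffs = 0" "ev eplus square_diffs = 0"
  "ev e1 (pair_squares t) = 0" "ev eminus (pair_squares t) = 6 - 6 * t"
  "ev eplus (pair_squares t) = 6 + 6 * t"
  by (simp_all add: square_diffs_def pair_squares_def ev_span_quartic sum_4 prod_4 vector_4)

text \<open>Expansion in the dual basis: the divisors 3, 12, 12 are the nonzero values in
  \<open>ev_dual_basis\<close> at \<open>t = -1\<close> and \<open>t = 1\<close>.\<close>

lemma quartic_expansion:
  "f = (ev e1 f / 3) *\<^sub>R square_diffs + (ev eminus f / 12) *\<^sub>R pair_squares (-1) +
    (ev eplus f / 12) *\<^sub>R pair_squares 1"
proof -
  have "homogeneous 4 (poly_of f)" "D4_invariant (poly_of f)"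
    using poly_of[of f] by auto
  then obtain A B C where f: "\<And>x. ev x f = A * (\<Sum>i\<in>UNIV. (x $ i) ^ 4) +
    B * ((\<Sum>i\<in>UNIV. (x $ i) ^ 2) ^ 2 - (\<Sum>i\<in>UNIV. (x $ i) ^ 4)) + C * (\<Prod>i\<in>UNIV. x $ i)"
    unfolding ev_def by (rule invariant_quartic_eval) blast
  \<comment> \<open>At a vector with all entries 1 or -1, the factor of \<open>B\<close> is 16 - 4 =
    12.\<close>
  have point_values: "ev e1 f = A" "ev eminus f = 4 * A + 12 * B - C" "ev eplus f = 4 * A + 12 * B + C"
    by (simp_all add: f sum_4 prod_4 vector_4)
  show ?thesis
    by (intro D4_quartic_eqI, simp only: point_values ev_add ev_scaleR)
      (simp add: f square_diffs_def pair_squares_def ev_span_quartic field_simps)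
qed

section \<open>Independence of the evaluations and the dual cone\<close>

text \<open>Applied to each of the three dual forms, a linear relation retains a single
  coefficient.\<close>

lemma evaluations_independent: "independent {ev e1, ev eminus, ev eplus}"
proof -
  \<comment> \<open>Distinctness is needed to split the sum over the set into three terms.\<close>
  have neq: "ev e1 \<noteq> ev eminus" "ev e1 \<noteq> ev eplus" "ev eminus \<noteq> ev eplus"
    using ev_dual_basis(1-3) ev_dual_basis(5,6)[of 1] by (auto dest: fun_cong)
  have "u v = 0" if eq: "(\<Sum>v\<in>{ev e1, ev eminus, ev eplus}. u v *\<^sub>R v) = 0"
    and v: "v \<in> {ev e1, ev eminus, ev eplus}" for u v
  proof -
    have "u (ev e1) * ev e1 f + (u (ev eminus) * ev eminus f + u (ev eplus) * ev eplus f) = 0" for f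
      using fun_cong[OF eq, of f] neq by (simp add: scaleR_fun_def)
    from this[of square_diffs] this[of "pair_squares 1"] this[of "pair_squares (-1)"] v
    show ?thesis by (auto simp: ev_dual_basis)
  qed
  then show ?thesis
    by (intro independent_if_scalars_zero) auto
qed

lemma convex_cone_dual_cone: "convex_cone (dual_cone K)"
proof -
  have "(\<lambda>_. 0) \<in> dual_cone K"
    by (auto simp: dual_cone_def linear_iff)
  moreover have "k + l \<in> dual_cone K" if "k \<in> dual_cone K" "l \<in> dual_cone K" for k l
    using that by (auto simp: dual_cone_def linear_iff algebra_simps)
  moreover have "c *\<^sub>R l \<in> dual_cone K" if "0 \<le> c" "l \<in> dual_cone K" for c l
    using that by (auto simp: dual_cone_def linear_iff scaleR_fun_def algebra_simps)
  ultimately show ?thesis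
    by (simp add: convex_cone_iff zero_fun_def)
qed

text \<open>One inclusion holds because values of sums of squares are nonnegative and a dual cone is
  a convex cone. For the other, applying \<open>l\<close> to \<open>quartic_expansion\<close>
  exchanges roles: the values of \<open>l\<close> on the three sums of squares become the
  coefficients of the evaluations.\<close>

lemma dual_cone_Sigma_D4: "dual_cone Sigma_D4 = convex_cone hull {ev e1, ev eminus, ev eplus}"
  (is "_ = ?C")
proof
  show "?C \<subseteq> dual_cone Sigma_D4"
    by (rule hull_minimal) (auto simp: ev_mem_dual_cone convex_cone_dual_cone)
  show "dual_cone Sigma_D4 \<subseteq> ?C"
  proof
    fix l assume l: "l \<in> dual_cone Sigma_D4"
    then have lin: "linear l" and nonneg: "0 \<le> l square_diffs" "0 \<le> l (pair_squares (-1))"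
      "0 \<le> l (pair_squares 1)"
      using square_diffs_sos pair_squares_sos[of "-1"] pair_squares_sos[of 1]
      by (simp_all add: dual_cone_def)
    have "l f = ((l square_diffs / 3) *\<^sub>R ev e1 + (l (pair_squares (-1)) / 12) *\<^sub>R ev eminus +
        (l (pair_squares 1) / 12) *\<^sub>R ev eplus) f" for f
      by (subst quartic_expansion[of f])
        (simp add: linear_add[OF lin] linear_scale[OF lin] scaleR_fun_def mult.commute)
    then have "l = (l square_diffs / 3) *\<^sub>R ev e1 + (l (pair_squares (-1)) / 12) *\<^sub>R ev eminus +
        (l (pair_squares 1) / 12) *\<^sub>R ev eplus"
      by (rule ext)
    also have "\<dots> \<in> ?C"
      using nonneg convex_cone_convex_cone_hull[of "{ev e1, ev eminus, ev eplus}"]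
      by (intro convex_cone_add convex_cone_scaleR) (auto intro: hull_inc)
    finally show "l \<in> ?C" .
  qed
qed

theorem theorem4p23:
  shows "simplicial_cone (dual_cone Sigma_D4) \<and>
    dual_cone Sigma_D4 =
      convex_cone hull {ev (vector [1, 0, 0, 0]), ev (vector [1, 1, 1, -1]), ev (vector [1, 1, 1, 1])}"
  unfolding simplicial_cone_def
  using evaluations_independent dual_cone_Sigma_D4
  by (intro conjI exI[of _ "{ev e1, ev eminus, ev eplus}"]) simp_all

end
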